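(* Let $p=p(n)$ satisfy $\frac{3\log n}{n}\le p\le 0.99$ and let $G\sim\mathcal{G}(n,p)$. Then asymptotically almost surely $G$ has a legal system.
   Context: $\mathcal{G}(n,p)$ is the Erdős–Rényi random graph on $n$ vertices with each edge present independently with probability $p$; $\log$ is the natural logarithm. Let $G=(V,E)$ be a finite simple graph. Subsets of $V$ are identified with elements of $\mathbb{Z}_2^{V}$ (group operation: symmetric difference), and $g$ acts on $S\subseteq V$ by $g(S)=g\,\triangle\, S$. A subset $S\subseteq V$ is a legal state if both $S$ and $V\setminus S$ are non-empty and induce connected subgraphs of $G$. For $v\in V$, a move at $v$ is a set $M_v\subseteq V$ with $v\in M_v$ and $M_v\cap N(v)=\emptyset$. Given moves $\mathcal{M}=\{M_v:v\in V\}$ and $S\subseteq V$, the triple $(G,S,\mathcal{M})$ is a legal system if $g(S)$ is a legal state for every $g\in\langle\mathcal{M}\rangle\le\mathbb{Z}_2^V$. $G$ has a legal system if such $S,\mathcal{M}$ exist. "Asymptotically almost surely" means with probability tending to $1$ as $n\to\infty$. *)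

theory Defs
  imports "HOL-Probability.Probability" "HOL-Algebra.Generated_Groups"
begin

text \<open>A graph is given by its vertex set \<^term>\<open>V\<close> and the set \<^term>\<open>E\<close> of its edges, each edge being
  a two-element subset of \<^term>\<open>V\<close>.\<close>

definition all_edges :: "'a set \<Rightarrow> 'a set set" where
  "all_edges V = {e. e \<subseteq> V \<and> card e = 2}"

definition finite_simple_graph :: "'a set \<Rightarrow> 'a set set \<Rightarrow> bool" where
  "finite_simple_graph V E \<longleftrightarrow> finite V \<and> E \<subseteq> all_edges V"

definition neighbourhood :: "'a set \<Rightarrow> 'a set set \<Rightarrow> 'a \<Rightarrow> 'a set" where
  "neighbourhood V E v = {u \<in> V. {u, v} \<in> E}"

definition induced_edges :: "'a set set \<Rightarrow> 'a set \<Rightarrow> 'a set set" where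
  "induced_edges E S = {e \<in> E. e \<subseteq> S}"

definition connected_graph :: "'a set \<Rightarrow> 'a set set \<Rightarrow> bool" where
  "connected_graph V E \<longleftrightarrow>
     V \<noteq> {} \<and> (\<forall>u\<in>V. \<forall>v\<in>V. (u, v) \<in> {(x, y). {x, y} \<in> E}\<^sup>*)"

definition legal_state :: "'a set \<Rightarrow> 'a set set \<Rightarrow> 'a set \<Rightarrow> bool" where
  "legal_state V E S \<longleftrightarrow>
     S \<subseteq> V \<and> S \<noteq> {} \<and> V - S \<noteq> {} \<and>
     connected_graph S (induced_edges E S) \<and>
     connected_graph (V - S) (induced_edges E (V - S))"

definition is_move :: "'a set \<Rightarrow> 'a set set \<Rightarrow> 'a \<Rightarrow> 'a set \<Rightarrow> bool" where
  "is_move V E v A \<longleftrightarrow> A \<subseteq> V \<and> v \<in> A \<and> A \<inter> neighbourhood V E v = {}"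

text \<open>The group $\mathbb{Z}_2^V$, with its elements regarded as subsets of \<^term>\<open>V\<close>.\<close>

definition subset_group :: "'a set \<Rightarrow> 'a set monoid" where
  "subset_group V = \<lparr>carrier = Pow V, mult = sym_diff, one = {}\<rparr>"

lemma comm_group_subset_group: "comm_group (subset_group V)"
proof (rule comm_groupI)
  fix x assume "x \<in> carrier (subset_group V)"
  then show "\<exists>y\<in>carrier (subset_group V). y \<otimes>\<^bsub>subset_group V\<^esub> x = \<one>\<^bsub>subset_group V\<^esub>"
    by (intro bexI[of _ x]) (auto simp: subset_group_def)
qed (auto simp: subset_group_def)

definition legal_system :: "'a set \<Rightarrow> 'a set set \<Rightarrow> 'a set \<Rightarrow> ('a \<Rightarrow> 'a set) \<Rightarrow> bool" where
  "legal_system V E S M \<longleftrightarrow>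
     S \<subseteq> V \<and> (\<forall>v\<in>V. is_move V E v (M v)) \<and>
     (\<forall>g\<in>generate (subset_group V) (M ` V). legal_state V E (sym_diff g S))"

definition has_legal_system :: "'a set \<Rightarrow> 'a set set \<Rightarrow> bool" where
  "has_legal_system V E \<longleftrightarrow> (\<exists>S M. legal_system V E S M)"

text \<open>The random graph $\mathcal{G}(n,p)$ on the vertex set \<^term>\<open>{..<n}\<close>, as a distribution on edge
  sets. Note that \<^const>\<open>bernoulli_pmf\<close> truncates its argument to the unit interval.\<close>

definition gnp :: "nat \<Rightarrow> real \<Rightarrow> nat set set pmf" where
  "gnp n p = map_pmf (\<lambda>f. {e \<in> all_edges {..<n}. f e})
     (Pi_pmf (all_edges {..<n}) False (\<lambda>_. bernoulli_pmf p))"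

lemma finite_simple_graph_gnp:
  assumes "E \<in> set_pmf (gnp n p)"
  shows "finite_simple_graph {..<n} E"
  using assms by (auto simp: gnp_def finite_simple_graph_def)

end

theory Submission
  imports Defs "HOL-Real_Asymp.Real_Asymp"
begin

text \<open>Colour the graph properly with \<open>K\<close> colours and let \<open>M v\<close> be the colour class of \<open>v\<close>. The moves
  generate a group of at most \<open>2 ^ K\<close> elements. If the starting set \<open>S\<close> is chosen uniformly at random,
  each set it can reach is again uniform, so by a union bound a good \<open>S\<close> exists as soon as fewer than
  \<open>2 ^ n / 2 ^ (K + 1)\<close> vertex sets induce a disconnected graph. In \<open>G(n, p)\<close> with
  \<open>p n \<ge> 3 ln n\<close> the expected proportion of such sets is at most \<open>exp (- c p n)\<close>: apart from
  small sets, which are rare, cutting off \<open>a\<close> vertices costs about \<open>exp (- a p n / 2)\<close>, which beats the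
  \<open>n ^ a \<le> exp (a p n / 3)\<close> choices.

  It remains to colour \<open>G(n, p)\<close> with \<open>K \<le> \<epsilon> p n\<close> colours for a small \<open>\<epsilon>\<close>; first fit does it. Each vertex
  is barred from all of the first \<open>K / 2\<close> colours with probability at most \<open>exp (- c' p n)\<close>, so only
  \<open>r = n exp (- \<theta> p n)\<close> vertices are. As \<open>p r\<close> is tiny, no vertex is then
  likely to have earlier neighbours in all of the next \<open>K / 2\<close> classes.\<close>

section \<open>Legal systems from proper colourings\<close>

text \<open>The empty set belongs to this family, as \<open>connected_graph\<close> asks for a
  vertex. Avoiding the family therefore also gives the non-emptiness that a legal state
  requires.\<close>

definition disconnected_sets :: "'a set \<Rightarrow> 'a set set \<Rightarrow> 'a set set" where
  "disconnected_sets V E = {S. S \<subseteq> V \<and> \<not> connected_graph S (induced_edges E S)}"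

lemma finite_disconnected_sets: "finite V \<Longrightarrow> finite (disconnected_sets V E)"
  by (rule finite_subset[of _ "Pow V"]) (auto simp: disconnected_sets_def)

text \<open>Every set is its own inverse under symmetric difference, so closure under inverses comes
  for free.\<close>

lemma generate_subset_groupI:
  assumes "H \<subseteq> Pow V" "{} \<in> H" "\<And>a b. a \<in> H \<Longrightarrow> b \<in> H \<Longrightarrow> sym_diff a b \<in> H"
    and "B \<subseteq> H"
  shows "generate (subset_group V) B \<subseteq> H"
proof
  fix g assume "g \<in> generate (subset_group V) B"
  then show "g \<in> H"
  proof (induction rule: generate.induct)
    case (inv h)
    have "inv\<^bsub>subset_group V\<^esub> h = h"
    proof (rule group.inv_equality)
      show "Group.group (subset_group V)"
        by (rule comm_group.axioms(2)[OF comm_group_subset_group])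
    qed (use inv assms in \<open>auto simp: subset_group_def\<close>)
    then show ?case using inv assms by auto
  qed (use assms in \<open>auto simp: subset_group_def\<close>)
qed

text \<open>No vertex has a neighbour of its own colour, so colour classes are moves. Each of the at
  most \<open>2 ^ K\<close> reachable translations rules out those \<open>S\<close> for which the
  new state or its complement is disconnected; these two options give the exponent
  \<open>K + 1\<close>.\<close>

lemma has_legal_system_if_few_disconnected:
  fixes c :: "'a \<Rightarrow> nat"
  assumes V: "finite V"
    and col: "\<And>u v. {u, v} \<in> E \<Longrightarrow> c u \<noteq> c v" "\<And>v. v \<in> V \<Longrightarrow> c v < K"
    and few: "2 ^ (K + 1) * card (disconnected_sets V E) < 2 ^ card V"
  shows "has_legal_system V E"
proof -
  \<comment> \<open>\<open>cl\<close> carries symmetric differences of colour sets to those of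
    vertex sets, so \<open>H\<close> is closed under the group operation.\<close>
  define cl where "cl J = {u \<in> V. c u \<in> J}" for J
  define H where "H = cl ` Pow {..<K}"
  define D where "D = disconnected_sets V E"
  have fH: "finite H" and cH: "card H \<le> 2 ^ K"
    using card_image_le[of "Pow {..<K}" cl] by (simp_all add: H_def card_Pow)
  have fD: "finite D"
    using V by (simp add: D_def finite_disconnected_sets)
  \<comment> \<open>Translation by \<open>h\<close> is an involution:
    \<open>sym_diff h S = B\<close> means \<open>S = sym_diff h B\<close>. So \<open>T\<close> holds
    every start that some \<open>h\<close> sends into \<open>D\<close> or to the complement of a
    member of \<open>D\<close>.\<close>
  define T where "T = (\<Union>h\<in>H. (\<lambda>B. sym_diff h B) ` D \<union> (\<lambda>B. sym_diff h (V - B)) ` D)"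
  have "card T \<le> (\<Sum>h\<in>H. card ((\<lambda>B. sym_diff h B) ` D \<union> (\<lambda>B. sym_diff h (V - B)) ` D))"
    unfolding T_def using fH by (rule card_UN_le)
  also have "\<dots> \<le> (\<Sum>h\<in>H. card D + card D)"
    by (intro sum_mono order_trans[OF card_Un_le] add_mono card_image_le fD)
  also have "\<dots> = card H * (2 * card D)" by simp
  also have "\<dots> \<le> 2 ^ K * (2 * card D)" using cH by (rule mult_right_mono) simp
  also have "\<dots> < card (Pow V)" using few V by (simp add: D_def card_Pow)
  finally have "card T < card (Pow V)" .
  moreover have "finite T" using fH fD by (simp add: T_def)
  ultimately have "\<not> Pow V \<subseteq> T" using card_mono by (meson leD)
  then obtain S where S: "S \<subseteq> V" "S \<notin> T" by auto
  define M where "M v = cl {c v}" for v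
  have "legal_state V E (sym_diff g S)" if g: "g \<in> generate (subset_group V) (M ` V)" for g
  proof -
    have "generate (subset_group V) (M ` V) \<subseteq> H"
    proof (rule generate_subset_groupI)
      show "H \<subseteq> Pow V" by (auto simp: H_def cl_def)
      show "{} \<in> H" unfolding H_def by (rule image_eqI[of _ _ "{}"]) (auto simp: cl_def)
      show "M ` V \<subseteq> H" using col(2) by (auto simp: H_def M_def)
      fix a b assume "a \<in> H" "b \<in> H"
      then obtain I J where "I \<subseteq> {..<K}" "J \<subseteq> {..<K}" "a = cl I" "b = cl J"
        by (auto simp: H_def)
      then show "sym_diff a b \<in> H"
        unfolding H_def by (intro image_eqI[of _ _ "sym_diff I J"]) (auto simp: cl_def)
    qed
    with g have gH: "g \<in> H" by auto
    then have gV: "g \<subseteq> V" by (auto simp: H_def cl_def)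
    have *: "B \<notin> D" if "S = sym_diff g B \<or> S = sym_diff g (V - B)" for B
      using S(2) gH that unfolding T_def by blast
    have "sym_diff g S \<notin> D" by (rule *) auto
    moreover have "V - sym_diff g S \<notin> D" by (rule *) (use gV S(1) in auto)
    moreover have "sym_diff g S \<subseteq> V" using gV S(1) by auto
    ultimately show ?thesis
      unfolding legal_state_def D_def disconnected_sets_def connected_graph_def by auto
  qed
  moreover have "is_move V E v (M v)" if "v \<in> V" for v
    using that col(1) by (auto simp: is_move_def M_def cl_def neighbourhood_def)
  ultimately have "legal_system V E S M" using S(1) by (auto simp: legal_system_def)
  then show ?thesis by (auto simp: has_legal_system_def)
qed

text \<open>One side of the cut is the component of a vertex that does not reach everything;
  \<open>U\<close> is this component or the rest of \<open>S\<close>, whichever is small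
  enough.\<close>

lemma disconnected_cut:
  assumes S: "finite S" "S \<noteq> {}" and disc: "\<not> connected_graph S (induced_edges E S)"
  obtains U where "U \<subseteq> S" "U \<noteq> {}" "2 * card U \<le> card S"
    "\<And>u w. u \<in> U \<Longrightarrow> w \<in> S - U \<Longrightarrow> {u, w} \<notin> E"
proof -
  let ?r = "{(x, y). {x, y} \<in> induced_edges E S}"
  obtain a b where ab: "a \<in> S" "b \<in> S" "(a, b) \<notin> ?r\<^sup>*"
    using S(2) disc unfolding connected_graph_def by auto
  define R where "R = {y \<in> S. (a, y) \<in> ?r\<^sup>*}"
  have RS: "R \<subseteq> S" "a \<in> R" "b \<in> S - R" using ab by (auto simp: R_def)
  have cut: "{u, w} \<notin> E" if "u \<in> R" "w \<in> S - R" for u w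
  proof
    assume "{u, w} \<in> E"
    then have "(u, w) \<in> ?r" using that by (auto simp: R_def induced_edges_def)
    moreover have "(a, u) \<in> ?r\<^sup>*" using that by (auto simp: R_def)
    ultimately have "(a, w) \<in> ?r\<^sup>*" by (rule rtrancl.rtrancl_into_rtrancl[rotated])
    then show False using that by (auto simp: R_def)
  qed
  have card: "card R + card (S - R) = card S"
    using S(1) RS(1) by (simp add: card_Diff_subset card_mono finite_subset)
  show ?thesis
  proof (cases "2 * card R \<le> card S")
    case True
    then show ?thesis using that[of R] RS cut by auto
  next
    case False
    have "{u, w} \<notin> E" if "u \<in> S - R" "w \<in> S - (S - R)" for u w
      using cut[of w u] that by (auto simp: insert_commute)
    then show ?thesis using False that[of "S - R"] RS card by auto
  qed
qed

section \<open>Independent edges\<close>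

text \<open>Fubini: expose the coordinates in \<open>A\<close> first. Given them, the event has
  probability at most \<open>c\<close> on \<open>X\<close> and zero off \<open>X\<close>.\<close>

lemma prob_Pi_pmf_Un_le:
  assumes AB: "finite A" "finite B" "A \<inter> B = {}" and "0 \<le> c"
    and sec: "\<And>f. measure_pmf.prob (Pi_pmf B d q) {g. (\<lambda>x. if x \<in> A then f x else g x) \<in> Y}
                \<le> c * indicator X f"
  shows "measure_pmf.prob (Pi_pmf (A \<union> B) d q) Y \<le> measure_pmf.prob (Pi_pmf A d q) X * c"
proof -
  let ?A = "Pi_pmf A d q" and ?B = "Pi_pmf B d q"
  let ?h = "\<lambda>f g x. if x \<in> A then f x else g x"
  have "Pi_pmf (A \<union> B) d q = bind_pmf ?A (\<lambda>f. map_pmf (?h f) ?B)"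
    by (simp add: Pi_pmf_union AB pair_pmf_def map_bind_pmf map_pmf_def bind_assoc_pmf bind_return_pmf)
  then have "emeasure (Pi_pmf (A \<union> B) d q) Y = (\<integral>\<^sup>+f. emeasure ?B (?h f -` Y) \<partial>?A)"
    by simp
  also have "\<dots> \<le> (\<integral>\<^sup>+f. ennreal c * indicator X f \<partial>?A)"
  proof (rule nn_integral_mono)
    fix f
    have "emeasure ?B (?h f -` Y) \<le> ennreal (c * indicator X f)"
      using sec[of f] by (simp add: vimage_def measure_pmf.emeasure_eq_measure ennreal_leI)
    then show "emeasure ?B (?h f -` Y) \<le> ennreal c * indicator X f"
      by (cases "f \<in> X") simp_all
  qed
  also have "\<dots> = ennreal c * emeasure ?A X"
    by (simp add: nn_integral_cmult_indicator)
  finally show ?thesis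
    using \<open>0 \<le> c\<close>
    by (simp add: measure_pmf.emeasure_eq_measure ennreal_mult[symmetric] mult.commute)
qed

lemma prob_no_hit:
  fixes D A :: "'a set" and p :: real
  assumes "finite A" "D \<subseteq> A" "0 \<le> p" "p \<le> 1"
  shows "measure_pmf.prob (Pi_pmf A False (\<lambda>_. bernoulli_pmf p)) {f. \<forall>e\<in>D. \<not> f e}
           = (1 - p) ^ card D"
proof -
  let ?B = "\<lambda>e. if e \<in> D then {False} else UNIV"
  have "{f. \<forall>e\<in>D. \<not> f e} = Pi A ?B" using assms(2) by (auto simp: Pi_def)
  then have "measure_pmf.prob (Pi_pmf A False (\<lambda>_. bernoulli_pmf p)) {f. \<forall>e\<in>D. \<not> f e}
     = (\<Prod>e\<in>A. measure_pmf.prob (bernoulli_pmf p) (?B e))"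
    using assms(1) by (simp add: measure_Pi_pmf_Pi)
  also have "\<dots> = (\<Prod>e\<in>A. if e \<in> D then 1 - p else 1)"
    using assms(3,4) by (intro prod.cong) (auto simp: measure_pmf_single)
  also have "\<dots> = (1 - p) ^ card D"
    using assms(1,2) by (simp add: prod.If_cases Int_absorb1)
  finally show ?thesis .
qed

text \<open>Disjoint blocks are hit independently. Blocks are exposed one at a time, each
  contributing the complement of the probability in \<open>prob_no_hit\<close>.\<close>

lemma prob_hit_all_le:
  fixes D :: "'j \<Rightarrow> 'a set" and p :: real
  assumes "finite J" "finite A" "0 \<le> p" "p \<le> 1"
    and "\<And>j. j \<in> J \<Longrightarrow> D j \<subseteq> A" "disjoint_family_on D J"
  shows "measure_pmf.prob (Pi_pmf A False (\<lambda>_. bernoulli_pmf p)) {f. \<forall>j\<in>J. \<exists>e\<in>D j. f e}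
           \<le> (\<Prod>j\<in>J. 1 - (1 - p) ^ card (D j))"
  using assms
proof (induction J arbitrary: A rule: finite_induct)
  case (insert j J)
  let ?P = "\<lambda>A. measure_pmf.prob (Pi_pmf A False (\<lambda>_. bernoulli_pmf p))"
  let ?c = "\<Prod>j\<in>J. 1 - (1 - p) ^ card (D j)"
  have disj: "D i \<inter> D j = {}" if "i \<in> J" for i
    using insert.prems(5) insert.hyps(2) that by (auto simp: disjoint_family_on_def)
  have IH: "?P (A - D j) {f. \<forall>j\<in>J. \<exists>e\<in>D j. f e} \<le> ?c"
    using insert.prems disj by (intro insert.IH) (auto simp: disjoint_family_on_def)
  have c0: "0 \<le> ?c" using insert.prems by (intro prod_nonneg) (auto simp: power_le_one)
  have fin: "finite (D j)" using insert.prems by (meson finite_subset insertI1)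
  have "?P (D j \<union> (A - D j)) {f. \<forall>j\<in>insert j J. \<exists>e\<in>D j. f e} \<le> ?P (D j) {f. \<exists>e\<in>D j. f e} * ?c"
  proof (rule prob_Pi_pmf_Un_le[OF fin])
    fix f :: "'a \<Rightarrow> bool"
    let ?h = "\<lambda>g x. if x \<in> D j then f x else g x"
    \<comment> \<open>The other blocks are disjoint from \<open>D j\<close>, so their hits must come
      from \<open>g\<close>.\<close>
    have "{g. ?h g \<in> {f. \<forall>j\<in>insert j J. \<exists>e\<in>D j. f e}}
            \<subseteq> (if \<exists>e\<in>D j. f e then {f. \<forall>j\<in>J. \<exists>e\<in>D j. f e} else {})"
    proof (intro subsetI)
      fix g assume g: "g \<in> {g. ?h g \<in> {f. \<forall>j\<in>insert j J. \<exists>e\<in>D j. f e}}"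
      then have "\<exists>e\<in>D j. f e" by auto
      moreover have "\<exists>e\<in>D i. g e" if "i \<in> J" for i
      proof -
        obtain e where "e \<in> D i" "?h g e" using g \<open>i \<in> J\<close> by blast
        then show ?thesis using disj[OF \<open>i \<in> J\<close>] by (metis disjoint_iff)
      qed
      ultimately show "g \<in> (if \<exists>e\<in>D j. f e then {f. \<forall>j\<in>J. \<exists>e\<in>D j. f e} else {})" by auto
    qed
    then have "?P (A - D j) {g. ?h g \<in> {f. \<forall>j\<in>insert j J. \<exists>e\<in>D j. f e}}
        \<le> ?P (A - D j) (if \<exists>e\<in>D j. f e then {f. \<forall>j\<in>J. \<exists>e\<in>D j. f e} else {})"
      by (intro measure_pmf.finite_measure_mono) auto
    also have "\<dots> \<le> ?c * indicator {f. \<exists>e\<in>D j. f e} f" using IH by auto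
    finally show "?P (A - D j) {g. ?h g \<in> {f. \<forall>j\<in>insert j J. \<exists>e\<in>D j. f e}}
        \<le> ?c * indicator {f. \<exists>e\<in>D j. f e} f" .
  qed (use insert.prems c0 in auto)
  moreover have "D j \<union> (A - D j) = A" using insert.prems by auto
  moreover have "?P (D j) {f. \<exists>e\<in>D j. f e} = 1 - ?P (D j) {f. \<forall>e\<in>D j. \<not> f e}"
    by (subst measure_pmf.prob_compl[symmetric]) (auto intro: arg_cong[where f = "?P (D j)"])
  then have "?P (D j) {f. \<exists>e\<in>D j. f e} = 1 - (1 - p) ^ card (D j)"
    using prob_no_hit[OF fin, of "D j" p] insert.prems by simp
  ultimately show ?case using insert.hyps by simp
qed simp

abbreviation random_edges :: "nat \<Rightarrow> real \<Rightarrow> (nat set \<Rightarrow> bool) pmf" where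
  "random_edges n p \<equiv> Pi_pmf (all_edges {..<n}) False (\<lambda>_. bernoulli_pmf p)"

abbreviation edges_of :: "nat \<Rightarrow> (nat set \<Rightarrow> bool) \<Rightarrow> nat set set" where
  "edges_of n f \<equiv> {e \<in> all_edges {..<n}. f e}"

lemma finite_all_edges: "finite V \<Longrightarrow> finite (all_edges V)"
  by (rule finite_subset[of _ "Pow V"]) (auto simp: all_edges_def)

text \<open>Markov's inequality for the number of events that occur, the expectation being expanded
  by linearity.\<close>

lemma markov_card:
  fixes M :: "'b pmf" and c :: real
  assumes "finite I" "0 < c"
  shows "measure_pmf.prob M {\<omega>. c \<le> real (card {i \<in> I. Q i \<omega>})}
           \<le> (\<Sum>i\<in>I. measure_pmf.prob M {\<omega>. Q i \<omega>}) / c"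
proof -
  have card: "real (card {i \<in> I. Q i \<omega>}) = (\<Sum>i\<in>I. indicator {\<omega>. Q i \<omega>} \<omega>)" for \<omega>
    using assms(1) by (simp add: indicator_def sum.If_cases Int_def)
  have "measure_pmf.prob M {\<omega> \<in> space M. c \<le> real (card {i \<in> I. Q i \<omega>})}
      \<le> measure_pmf.expectation M (\<lambda>\<omega>. real (card {i \<in> I. Q i \<omega>})) / c"
    unfolding card using assms
    by (intro integral_Markov_inequality_measure[where A = "{}"]) (auto intro!: sum_nonneg Bochner_Integration.integrable_sum measure_pmf.integrable_const_bound[where B = 1])
  also have "measure_pmf.expectation M (\<lambda>\<omega>. real (card {i \<in> I. Q i \<omega>}))
      = (\<Sum>i\<in>I. measure_pmf.prob M {\<omega>. Q i \<omega>})"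
    unfolding card
    by (subst Bochner_Integration.integral_sum)
      (auto intro!: measure_pmf.integrable_const_bound[where B = 1])
  finally show ?thesis by simp
qed

section \<open>Disconnected vertex sets\<close>

text \<open>Union bound over the smaller side of a cut, of size \<open>a\<close>: all
  \<open>a * (card S - a)\<close> pairs across it must be absent.\<close>

lemma prob_disconnected_le:
  fixes p :: real
  assumes S: "S \<subseteq> {..<n}" "S \<noteq> {}" and p: "0 \<le> p" "p \<le> 1"
  shows "measure_pmf.prob (random_edges n p) {f. S \<in> disconnected_sets {..<n} (edges_of n f)}
    \<le> (\<Sum>a = 1..card S div 2. (card S choose a) * (1 - p) ^ (a * (card S - a)))"
proof -
  let ?P = "measure_pmf.prob (random_edges n p)"
  have fS: "finite S" using S(1) finite_subset by blast
  define cut where "cut U = (\<lambda>(u, w). {u, w}) ` (U \<times> (S - U))" for U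
  define B where "B U = {f. \<forall>e\<in>cut U. \<not> f e}" for U :: "nat set"
  have PB: "?P (B U) = (1 - p) ^ (card U * (card S - card U))" if "U \<subseteq> S" for U
  proof -
    have "inj_on (\<lambda>(u, w). {u, w}) (U \<times> (S - U))"
      by (auto simp: inj_on_def doubleton_eq_iff)
    then have "card (cut U) = card U * (card S - card U)"
      using that fS by (simp add: cut_def card_image card_cartesian_product card_Diff_subset finite_subset)
    moreover have "cut U \<subseteq> all_edges {..<n}"
      using that S(1) by (auto simp: cut_def all_edges_def card_2_iff)
    ultimately show ?thesis
      unfolding B_def by (simp add: prob_no_hit finite_all_edges p)
  qed
  have "{f. S \<in> disconnected_sets {..<n} (edges_of n f)}
      \<subseteq> (\<Union>a\<in>{1..card S div 2}. \<Union>U\<in>{U. U \<subseteq> S \<and> card U = a}. B U)"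
  proof
    fix f assume "f \<in> {f. S \<in> disconnected_sets {..<n} (edges_of n f)}"
    then have "\<not> connected_graph S (induced_edges (edges_of n f) S)"
      by (simp add: disconnected_sets_def)
    then obtain U where U: "U \<subseteq> S" "U \<noteq> {}" "2 * card U \<le> card S"
      "\<And>u w. u \<in> U \<Longrightarrow> w \<in> S - U \<Longrightarrow> {u, w} \<notin> edges_of n f"
      using disconnected_cut[OF fS S(2)] by blast
    have "card U \<noteq> 0" using U fS by (simp add: finite_subset)
    then have "card U \<in> {1..card S div 2}" using U(3) by auto
    moreover have "f \<in> B U"
    proof -
      have "\<not> f {u, w}" if "u \<in> U" "w \<in> S - U" for u w
      proof -
        have "{u, w} \<in> all_edges {..<n}" using that U(1) S(1) by (auto simp: all_edges_def card_2_iff)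
        then show ?thesis using U(4)[OF that] by auto
      qed
      then show ?thesis by (auto simp: B_def cut_def)
    qed
    ultimately show "f \<in> (\<Union>a\<in>{1..card S div 2}. \<Union>U\<in>{U. U \<subseteq> S \<and> card U = a}. B U)"
      using U(1) by blast
  qed
  then have "?P {f. S \<in> disconnected_sets {..<n} (edges_of n f)}
      \<le> ?P (\<Union>a\<in>{1..card S div 2}. \<Union>U\<in>{U. U \<subseteq> S \<and> card U = a}. B U)"
    by (intro measure_pmf.finite_measure_mono) auto
  also have "\<dots> \<le> (\<Sum>a = 1..card S div 2. ?P (\<Union>U\<in>{U. U \<subseteq> S \<and> card U = a}. B U))"
    by (intro measure_pmf.finite_measure_subadditive_finite) auto
  also have "\<dots> \<le> (\<Sum>a = 1..card S div 2. \<Sum>U\<in>{U. U \<subseteq> S \<and> card U = a}. ?P (B U))"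
    using fS by (intro sum_mono measure_pmf.finite_measure_subadditive_finite) auto
  also have "\<dots> = (\<Sum>a = 1..card S div 2. (card S choose a) * (1 - p) ^ (a * (card S - a)))"
    using fS by (intro sum.cong) (auto simp: PB n_subsets)
  finally show ?thesis .
qed

text \<open>Put \<open>x = p * n\<close>. If \<open>24 * a \<le> n\<close>, the binomial is at most
  \<open>exp (x / 3) ^ a\<close> and \<open>s - a\<close> is at least \<open>10 / 24 * n\<close>;
  here \<open>1/3 - 10/24 = -1/12\<close>. Otherwise it is at most \<open>exp 24 ^ a\<close> and
  \<open>s - a\<close> is at least \<open>11 / 48 * n\<close>; then
  \<open>24 - 11 / 48 * x \<le> - x / 16\<close> amounts to \<open>144 \<le> x\<close>.\<close>

lemma cut_term_le:
  fixes p :: real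
  assumes p: "0 \<le> p" "p \<le> 1" and n: "real n \<le> exp (p * n / 3)" and big: "144 \<le> p * n"
    and s: "11 * n \<le> 24 * s" "s \<le> n" and a: "2 * a \<le> s"
  shows "(s choose a) * (1 - p) ^ (a * (s - a)) \<le> exp (- (p * n) / 16) ^ a"
proof -
  define x where "x = p * n"
  have x: "144 \<le> x" "0 \<le> x" using big by (auto simp: x_def)
  have "(1 - p) ^ (a * (s - a)) \<le> exp (- p) ^ (a * (s - a))"
    using p exp_ge_add_one_self[of "- p"] by (intro power_mono) auto
  also have "\<dots> = exp (- p * real (s - a)) ^ a"
    by (simp add: exp_of_nat_mult[symmetric] mult_ac)
  finally have q: "(1 - p) ^ (a * (s - a)) \<le> exp (- p * real (s - a)) ^ a" .
  show ?thesis
  proof (cases "24 * a \<le> n")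
    case True
    have "real (s - a) \<ge> 10 / 24 * n" using True s a by (simp add: of_nat_diff)
    then have "p * real (s - a) \<ge> p * (10 / 24 * n)" using p(1) by (rule mult_left_mono)
    then have e: "- p * real (s - a) \<le> - (10 / 24 * x)" by (simp add: x_def)
    have "real (s choose a) \<le> real s ^ a"
      using binomial_le_pow[of a s] a by (metis (mono_tags) le_trans le_add1 mult_2 of_nat_le_iff of_nat_power)
    also have "\<dots> \<le> exp (x / 3) ^ a"
      using s n by (intro power_mono) (auto simp: x_def)
    finally have "(s choose a) * (1 - p) ^ (a * (s - a)) \<le> exp (x / 3) ^ a * exp (- p * real (s - a)) ^ a"
      using q p by (intro mult_mono) auto
    also have "\<dots> = exp (x / 3 + - p * real (s - a)) ^ a"
      by (simp only: power_mult_distrib[symmetric] exp_add)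
    also have "\<dots> \<le> exp (- x / 16) ^ a"
      by (intro power_mono iffD2[OF exp_le_cancel_iff] exp_ge_zero) (use e x in linarith)
    finally show ?thesis by (simp add: x_def)
  next
    case False
    have "real (s - a) \<ge> 11 / 48 * n" using s a by (simp add: of_nat_diff)
    then have "p * real (s - a) \<ge> p * (11 / 48 * n)" using p(1) by (rule mult_left_mono)
    then have e: "- p * real (s - a) \<le> - (11 / 48 * x)" by (simp add: x_def)
    have "s choose a \<le> 2 ^ s" by (rule binomial_le_pow2)
    also have "\<dots> \<le> (2::nat) ^ (24 * a)" using False s by (intro power_increasing) auto
    finally have "real (s choose a) \<le> 2 ^ (24 * a)" by (metis of_nat_le_iff of_nat_numeral of_nat_power)
    also have "\<dots> \<le> exp 1 ^ (24 * a)" using exp_ge_add_one_self[of 1] by (intro power_mono) auto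
    also have "\<dots> = exp 24 ^ a" by (simp add: exp_of_nat_mult[symmetric])
    finally have "(s choose a) * (1 - p) ^ (a * (s - a)) \<le> exp 24 ^ a * exp (- p * real (s - a)) ^ a"
      using q p by (intro mult_mono) auto
    also have "\<dots> = exp (24 + - p * real (s - a)) ^ a"
      by (simp only: power_mult_distrib[symmetric] exp_add)
    also have "\<dots> \<le> exp (- x / 16) ^ a"
      by (intro power_mono iffD2[OF exp_le_cancel_iff] exp_ge_zero) (use e x in linarith)
    finally show ?thesis by (simp add: x_def)
  qed
qed

lemma sum_powers_le:
  fixes y :: real
  assumes "0 \<le> y" "y \<le> 1 / 2"
  shows "(\<Sum>a = 1..m. y ^ a) \<le> 2 * y"
proof -
  \<comment> \<open>Keeping a multiple of the next power on the left makes the bound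
    inductive.\<close>
  have "(\<Sum>a = 1..m. y ^ a) + 2 * y ^ (m + 1) \<le> 2 * y"
  proof (induction m)
    case (Suc m)
    have "2 * y ^ (m + 2) \<le> y ^ (m + 1)"
      using mult_left_mono[OF assms(2), of "y ^ (m + 1)"] assms(1) by (simp add: field_simps)
    then show ?case using Suc by simp
  qed simp
  then show ?thesis using assms(1) by (smt (verit) zero_le_power)
qed

text \<open>The cut terms are dominated by a geometric series of ratio at most \<open>1 / 2\<close>,
  hence by twice its first term.\<close>

lemma prob_big_disconnected_le:
  fixes p :: real
  assumes p: "0 \<le> p" "p \<le> 1" and n: "real n \<le> exp (p * n / 3)" and big: "144 \<le> p * n"
    and S: "S \<subseteq> {..<n}" "11 * n \<le> 24 * card S"
  shows "measure_pmf.prob (random_edges n p) {f. S \<in> disconnected_sets {..<n} (edges_of n f)}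
    \<le> 2 * exp (- (p * n) / 16)"
proof -
  have "n > 0" using big by (cases n) auto
  then have "S \<noteq> {}" using S by auto
  have sn: "card S \<le> n" using S(1) card_mono[of "{..<n}" S] by simp
  have "exp (- (p * n) / 16) \<le> exp (- 1)" using big by simp
  also have "\<dots> \<le> 1 / (2::real)" using exp_ge_add_one_self[of 1] by (simp add: exp_minus field_simps)
  finally have y: "exp (- (p * n) / 16) \<le> 1 / 2" .
  have "measure_pmf.prob (random_edges n p) {f. S \<in> disconnected_sets {..<n} (edges_of n f)}
    \<le> (\<Sum>a = 1..card S div 2. (card S choose a) * (1 - p) ^ (a * (card S - a)))"
    by (rule prob_disconnected_le) fact+
  also have "\<dots> \<le> (\<Sum>a = 1..card S div 2. exp (- (p * n) / 16) ^ a)"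
    using S(2) sn by (intro sum_mono cut_term_le p n big) auto
  also have "\<dots> \<le> 2 * exp (- (p * n) / 16)" using y by (intro sum_powers_le) auto
  finally show ?thesis .
qed

lemma sum_Pow_power_card:
  fixes t :: real
  assumes "finite V"
  shows "(\<Sum>S\<in>Pow V. t ^ card S) = (1 + t) ^ card V"
  using prod_add[OF assms, of "\<lambda>_. t" "\<lambda>_. 1"] by (simp add: add.commute)

text \<open>Chernoff's bound: each small set contributes at least \<open>t powr (11 n / 24)\<close> with \<open>t = 5/6\<close>
  to the generating function \<open>\<Sum>S. t ^ card S = (1 + t) ^ n\<close>.\<close>

lemma card_small_sets_le:
  "real (card {S. S \<subseteq> {..<n} \<and> 24 * card S < 11 * n}) \<le> 2 ^ n * exp (- real n / 312)"
proof -
  let ?N = "real (card {S. S \<subseteq> {..<n} \<and> 24 * card S < 11 * n})"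
  \<comment> \<open>\<open>w ^ n\<close> is the least weight of a small set in the sense above;
    comparing 24th powers keeps all exponents integral.\<close>
  define w :: real where "w = (5 / 6) powr (11 / 24)"
  have w: "w > 0" "w ^ 24 = (5 / 6) ^ 11"
    by (simp_all add: w_def powr_powr powr_realpow[symmetric] del: powr_numeral)
  have t: "w ^ n \<le> (5 / 6) ^ card S" if "24 * card S < 11 * n" for S :: "nat set"
  proof -
    have "(w ^ n) ^ 24 = (w ^ 24) ^ n" by (simp only: power_mult[symmetric] mult.commute)
    also have "\<dots> = (5 / 6) ^ (11 * n)" unfolding w(2) by (simp only: power_mult)
    also have "\<dots> \<le> (5 / 6) ^ (24 * card S)" using that by (intro power_decreasing) auto
    also have "\<dots> = ((5 / 6) ^ card S) ^ 24" by (simp only: power_mult[symmetric] mult.commute)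
    finally show ?thesis using power_le_imp_le_base[of "w ^ n" 23] by simp
  qed
  have "?N * w ^ n = (\<Sum>S\<in>{S. S \<subseteq> {..<n} \<and> 24 * card S < 11 * n}. w ^ n)" by simp
  also have "\<dots> \<le> (\<Sum>S\<in>{S. S \<subseteq> {..<n} \<and> 24 * card S < 11 * n}. (5 / 6) ^ card S)"
    using t by (intro sum_mono) auto
  also have "\<dots> \<le> (\<Sum>S\<in>Pow {..<n}. (5 / 6) ^ card S)"
    by (intro sum_mono2) auto
  also have "\<dots> = (11 / 6) ^ n" by (subst sum_Pow_power_card) auto
  finally have "?N * w ^ n \<le> (11 / 6) ^ n" .
  moreover have "11 / 6 \<le> 2 * exp (- 1 / 312) * w"
  proof -
    \<comment> \<open>The rate in the bound comes from here: \<open>312 = 13 * 24\<close>, and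
      \<open>1 - 1 / 13\<close> is the slack in this numerical comparison.\<close>
    have "(11 / 12) ^ 24 \<le> (1 - 1 / 13) * (5 / 6 :: real) ^ 11" by (simp add: power_divide field_simps)
    also have "\<dots> \<le> exp (- 1 / 13) * w ^ 24"
      unfolding w(2) using exp_ge_add_one_self[of "- 1 / 13"] by (intro mult_right_mono) auto
    also have "\<dots> = (exp (- 1 / 312) * w) ^ 24"
      by (simp add: power_mult_distrib exp_of_nat_mult[symmetric])
    finally have "11 / 12 \<le> exp (- 1 / 312) * w"
      using power_le_imp_le_base[of "11 / 12" 23 "exp (- 1 / 312) * w"] w(1) by simp
    then show ?thesis by simp
  qed
  then have "(11 / 6) ^ n \<le> (2 * exp (- 1 / 312) * w) ^ n" by (intro power_mono) auto
  ultimately have "?N * w ^ n \<le> 2 ^ n * exp (- real n / 312) * w ^ n"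
    by (simp add: power_mult_distrib exp_of_nat_mult[symmetric])
  then show ?thesis using w(1) by simp
qed

text \<open>Markov's inequality for the number of disconnected sets. Small sets are all counted as
  disconnected, the others through \<open>prob_big_disconnected_le\<close>.\<close>

lemma prob_many_disconnected_le:
  fixes p :: real
  assumes p: "0 \<le> p" "p \<le> 1" and n: "real n \<le> exp (p * n / 3)" and big: "144 \<le> p * n"
  shows "measure_pmf.prob (random_edges n p)
      {f. 2 ^ n \<le> 2 ^ (K + 1) * card (disconnected_sets {..<n} (edges_of n f))}
    \<le> 2 ^ (K + 1) * (3 * exp (- (p * n) / 312))"
proof -
  let ?P = "measure_pmf.prob (random_edges n p)"
  let ?E = "\<lambda>S. {f. S \<in> disconnected_sets {..<n} (edges_of n f)}"
  let ?small = "{S. S \<subseteq> {..<n} \<and> 24 * card S < 11 * n}"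
  have "p * n \<le> n" using p by (simp add: mult_left_le_one_le)
  have "(\<Sum>S\<in>Pow {..<n}. ?P (?E S))
     \<le> (\<Sum>S\<in>Pow {..<n}. indicator ?small S + 2 * exp (- (p * n) / 16))"
  proof (intro sum_mono)
    fix S assume "S \<in> Pow {..<n}"
    then show "?P (?E S) \<le> indicator ?small S + 2 * exp (- (p * n) / 16)"
      using prob_big_disconnected_le[OF p n big, of S]
      by (cases "S \<in> ?small") (auto intro: order_trans[OF measure_pmf.prob_le_1])
  qed
  also have "\<dots> = real (card ?small) + 2 ^ n * (2 * exp (- (p * n) / 16))"
    by (simp add: sum.distrib card_Pow indicator_def sum.If_cases)
      (auto intro: arg_cong[where f = card])
  \<comment> \<open>Both rates are weakened to the common \<open>p * n / 312\<close>; for the small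
    sets this uses \<open>p * n \<le> n\<close>.\<close>
  also have "\<dots> \<le> 2 ^ n * exp (- (p * n) / 312) + 2 ^ n * (2 * exp (- (p * n) / 312))"
    using \<open>p * n \<le> n\<close> big
    by (intro add_mono order_trans[OF card_small_sets_le] mult_left_mono) auto
  finally have sum: "(\<Sum>S\<in>Pow {..<n}. ?P (?E S)) \<le> 2 ^ n * (3 * exp (- (p * n) / 312))"
    by (simp add: algebra_simps)
  have "{f. 2 ^ n \<le> 2 ^ (K + 1) * card (disconnected_sets {..<n} (edges_of n f))}
     = {f. 2 ^ n / 2 ^ (K + 1) \<le> real (card {S \<in> Pow {..<n}. f \<in> ?E S})}"
  proof (intro Collect_cong)
    fix f :: "nat set \<Rightarrow> bool"
    have "{S \<in> Pow {..<n}. f \<in> ?E S} = disconnected_sets {..<n} (edges_of n f)"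
      by (auto simp: disconnected_sets_def)
    moreover have "2 ^ n \<le> 2 ^ (K + 1) * m \<longleftrightarrow> 2 ^ n / 2 ^ (K + 1) \<le> real m" for m :: nat
    proof -
      have "2 ^ n \<le> 2 ^ (K + 1) * m \<longleftrightarrow> real (2 ^ n) \<le> real (2 ^ (K + 1) * m)"
        by (rule of_nat_le_iff[symmetric])
      then show ?thesis by (simp add: field_simps)
    qed
    ultimately show "2 ^ n \<le> 2 ^ (K + 1) * card (disconnected_sets {..<n} (edges_of n f))
      \<longleftrightarrow> 2 ^ n / 2 ^ (K + 1) \<le> real (card {S \<in> Pow {..<n}. f \<in> ?E S})" by simp
  qed
  then have "?P {f. 2 ^ n \<le> 2 ^ (K + 1) * card (disconnected_sets {..<n} (edges_of n f))}
    \<le> (\<Sum>S\<in>Pow {..<n}. ?P {f. f \<in> ?E S}) / (2 ^ n / 2 ^ (K + 1))"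
    using markov_card[of "Pow {..<n}" "2 ^ n / 2 ^ (K + 1)" "random_edges n p" "\<lambda>S f. f \<in> ?E S"]
    by simp
  also have "\<dots> \<le> 2 ^ n * (3 * exp (- (p * n) / 312)) / (2 ^ n / 2 ^ (K + 1))"
    using sum by (intro divide_right_mono) auto
  also have "\<dots> = 2 ^ (K + 1) * (3 * exp (- (p * n) / 312))" by simp
  finally show ?thesis .
qed

section \<open>First-fit colouring of a random graph\<close>

text \<open>First fit in the natural order of the vertices, defined on all of \<open>nat\<close> so
  that the colouring does not involve \<open>n\<close>.\<close>

fun greedy :: "(nat set \<Rightarrow> bool) \<Rightarrow> nat \<Rightarrow> nat" where
  "greedy f v = (LEAST j. j \<notin> greedy f ` {u \<in> {..<v}. f {u, v}})"

declare greedy.simps [simp del]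

lemma greedy_proper:
  assumes "u < v" "f {u, v}"
  shows "greedy f u \<noteq> greedy f v"
proof -
  have "finite (greedy f ` {u \<in> {..<v}. f {u, v}})" by simp
  then have "\<exists>j. j \<notin> greedy f ` {u \<in> {..<v}. f {u, v}}"
    using ex_new_if_finite infinite_UNIV_nat by blast
  then have "greedy f v \<notin> greedy f ` {u \<in> {..<v}. f {u, v}}"
    by (subst greedy.simps) (rule LeastI_ex)
  moreover have "greedy f u \<in> greedy f ` {u \<in> {..<v}. f {u, v}}" using assms by auto
  ultimately show ?thesis by metis
qed

lemma greedy_blocked:
  assumes "j < greedy f v"
  shows "j \<in> greedy f ` {u \<in> {..<v}. f {u, v}}"
  using not_less_Least[of j "\<lambda>j. j \<notin> greedy f ` {u \<in> {..<v}. f {u, v}}"] assms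
  by (subst (asm) greedy.simps) auto

text \<open>This is what makes earlier colours independent of the edges at a later vertex.\<close>

lemma greedy_cong:
  assumes "\<And>u w. u < w \<Longrightarrow> w \<le> v \<Longrightarrow> f {u, w} = g {u, w}"
  shows "greedy f v = greedy g v"
  using assms
proof (induction v rule: less_induct)
  case (less v)
  have "greedy f ` {u \<in> {..<v}. f {u, v}} = greedy g ` {u \<in> {..<v}. g {u, v}}"
    using less by (intro image_cong) auto
  then show ?case by (simp add: greedy.simps[of _ v])
qed

text \<open>The classes of the vertices below \<open>v\<close> do not depend on the edges joining \<open>v\<close> to them,
  so these edges may be exposed last.\<close>

lemma prob_greedy_blocked_le:
  fixes p c :: real
  assumes v: "v < n" and J: "finite J" and p: "0 \<le> p" "p \<le> 1" and c: "0 \<le> c"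
    and bound: "\<And>s. R s \<Longrightarrow> (\<Sum>j\<in>J. s j) \<le> v \<Longrightarrow> (\<Prod>j\<in>J. 1 - (1 - p) ^ s j) \<le> c"
  shows "measure_pmf.prob (random_edges n p)
     {f. R (\<lambda>j. card {u \<in> {..<v}. greedy f u = j}) \<and>
         (\<forall>j\<in>J. j \<in> greedy f ` {u \<in> {..<v}. f {u, v}})} \<le> c"
    (is "measure_pmf.prob _ ?Y \<le> c")
proof -
  let ?S = "\<lambda>f j. card {u \<in> {..<v}. greedy f u = j}"
  define B where "B = (\<lambda>u. {u, v}) ` {..<v}"
  define A where "A = all_edges {..<n} - B"
  have fin: "finite A" "finite B" "A \<inter> B = {}"
    by (auto simp: A_def B_def finite_all_edges)
  have "B \<subseteq> all_edges {..<n}" using v by (auto simp: B_def all_edges_def card_2_iff)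
  then have AB: "A \<union> B = all_edges {..<n}" by (auto simp: A_def)
  have "measure_pmf.prob (Pi_pmf (A \<union> B) False (\<lambda>_. bernoulli_pmf p)) ?Y
     \<le> measure_pmf.prob (Pi_pmf A False (\<lambda>_. bernoulli_pmf p)) UNIV * c"
  proof (rule prob_Pi_pmf_Un_le[OF fin c])
    fix f :: "nat set \<Rightarrow> bool"
    \<comment> \<open>\<open>f'\<close> is free of \<open>g\<close> and agrees with
      \<open>?h g\<close> on \<open>A\<close>, which contains every pair below \<open>v\<close>. So
      the earlier colours are settled before \<open>B\<close> is exposed.\<close>
    define f' where "f' = (\<lambda>x. x \<in> A \<and> f x)"
    let ?h = "\<lambda>g x. if x \<in> A then f x else g x"
    let ?P = "measure_pmf.prob (Pi_pmf B False (\<lambda>_. bernoulli_pmf p))"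
    \<comment> \<open>Colour \<open>j\<close> is barred at \<open>v\<close> exactly when an edge of
      \<open>D j\<close> is present; the blocks are disjoint and have the sizes of the colour
      classes.\<close>
    define D where "D j = (\<lambda>u. {u, v}) ` {u \<in> {..<v}. greedy f' u = j}" for j
    have inj: "inj_on (\<lambda>u. {u, v}) X" for X by (auto simp: inj_on_def doubleton_eq_iff)
    have notA: "{u, v} \<notin> A" if "u < v" for u using that by (auto simp: A_def B_def)
    have old: "{u, w} \<in> A" if "u < w" "w < v" for u w
      using that v by (auto simp: A_def B_def all_edges_def card_2_iff doubleton_eq_iff)
    have same: "greedy (?h g) u = greedy f' u" if "u < v" for g u
      using that old by (intro greedy_cong) (auto simp: f'_def)
    have S: "?S (?h g) = ?S f'" for g
      using same by (intro ext arg_cong[where f = card] Collect_cong) (metis lessThan_iff)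
    have "?P {g. ?h g \<in> ?Y} \<le> c"
    proof (cases "R (?S f')")
      case True
      have "?P {g. ?h g \<in> ?Y} \<le> ?P {g. \<forall>j\<in>J. \<exists>e\<in>D j. g e}"
        by (intro measure_pmf.finite_measure_mono) (fastforce simp: D_def same notA)+
      also have "\<dots> \<le> (\<Prod>j\<in>J. 1 - (1 - p) ^ card (D j))"
      proof (rule prob_hit_all_le[OF J fin(2) p])
        show "disjoint_family_on D J"
          by (auto simp: disjoint_family_on_def D_def doubleton_eq_iff)
      qed (auto simp: D_def B_def)
      also have "\<dots> = (\<Prod>j\<in>J. 1 - (1 - p) ^ ?S f' j)"
        by (simp add: D_def card_image inj)
      also have "\<dots> \<le> c"
      proof (rule bound[OF True])
        have "(\<Sum>j\<in>J. ?S f' j) = card (\<Union>j\<in>J. {u \<in> {..<v}. greedy f' u = j})"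
          using J by (subst card_UN_disjoint) auto
        also have "\<dots> \<le> card {..<v}" by (intro card_mono) auto
        finally show "(\<Sum>j\<in>J. ?S f' j) \<le> v" by simp
      qed
      finally show ?thesis .
    next
      case False
      then have "\<not> R (?S (?h g))" for g by (simp only: S not_False_eq_True)
      then have empty: "{g. ?h g \<in> ?Y} = {}" by blast
      show ?thesis unfolding empty using c by simp
    qed
    then show "?P {g. ?h g \<in> ?Y} \<le> c * indicator UNIV f" by simp
  qed
  then show ?thesis using AB by simp
qed

text \<open>By convexity \<open>exp (- (10 * p))\<close> lies below its chord over
  \<open>[0, 0.99]\<close>. The line \<open>1 - p\<close> meets it at \<open>0\<close> and is above
  it at \<open>0.99\<close>, as \<open>exp (- 9.9) \<le> 1 / 100\<close>.\<close>

lemma exp_minus_10_le: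
  fixes p :: real
  assumes "0 \<le> p" "p \<le> 0.99"
  shows "exp (- (10 * p)) \<le> 1 - p"
proof -
  have "100 \<le> (2::real) ^ 9" by simp
  also have "\<dots> \<le> exp 1 ^ 9" using exp_ge_add_one_self[of 1] by (intro power_mono) auto
  also have "\<dots> = exp 9" by (simp add: exp_of_nat_mult[symmetric])
  also have "\<dots> \<le> exp (9.9::real)" by simp
  finally have e: "exp (- 9.9) \<le> (1 / 100 :: real)" by (simp add: exp_minus field_simps)
  define l where "l = p / 0.99"
  have l: "0 \<le> l" "l \<le> 1" "p = 0.99 * l" using assms by (auto simp: l_def)
  have "exp ((1 - l) *\<^sub>R 0 + l *\<^sub>R (- 9.9)) \<le> (1 - l) * exp 0 + l * exp (- 9.9)"
    using convex_onD[OF exp_convex, of l 0 "- 9.9"] l by simp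
  also have "\<dots> \<le> (1 - l) * 1 + l * (1 / 100)" using e l by (intro add_mono mult_left_mono) auto
  finally show ?thesis unfolding l(3) by (simp add: mult.commute)
qed

text \<open>Jensen's inequality, by way of the tangent of \<open>exp\<close> at the average exponent.\<close>

lemma prod_miss_le:
  fixes p :: real and k n :: nat
  assumes p: "0 \<le> p" "p \<le> 0.99" and k: "0 < k" and s: "(\<Sum>j<k. s j) \<le> n"
  shows "(\<Prod>j<k. 1 - (1 - p) ^ s j) \<le> exp (- (k * exp (- (10 * p * n / k))))"
proof -
  \<comment> \<open>The average of the exponents \<open>- (10 * p) * s j\<close> if the sizes sum to
    \<open>n\<close>, and a lower bound for it in general.\<close>
  define y where "y = - (10 * p * n / k)"
  have "k * exp y \<le> (\<Sum>j<k. exp y * (1 + (- (10 * p) * s j - y)))"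
  proof -
    have "(\<Sum>j<k. - (10 * p) * real (s j) - y) = - (10 * p) * (\<Sum>j<k. real (s j)) - k * y"
      by (simp add: sum_subtractf sum_distrib_left sum_negf)
    also have "\<dots> = 10 * p * (n - real (\<Sum>j<k. s j))"
      using k by (simp add: y_def field_simps)
    also have "\<dots> \<ge> 0" using of_nat_mono[OF s, where 'a = real] p(1) by (intro mult_nonneg_nonneg) auto
    finally have "0 \<le> exp y * (\<Sum>j<k. - (10 * p) * real (s j) - y)" by simp
    then show ?thesis by (simp only: sum_distrib_left[symmetric] sum.distrib) (simp add: algebra_simps)
  qed
  also have "\<dots> \<le> (\<Sum>j<k. (1 - p) ^ s j)"
  proof (intro sum_mono)
    fix j
    have "exp y * (1 + (- (10 * p) * s j - y)) \<le> exp y * exp (- (10 * p) * s j - y)"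
      by (intro mult_left_mono exp_ge_add_one_self) auto
    also have "\<dots> = exp (- (10 * p)) ^ s j"
      by (simp add: exp_add[symmetric] exp_of_nat_mult[symmetric] mult_ac)
    also have "\<dots> \<le> (1 - p) ^ s j" using exp_minus_10_le[OF p] by (intro power_mono) auto
    finally show "exp y * (1 + (- (10 * p) * s j - y)) \<le> (1 - p) ^ s j" .
  qed
  finally have sum: "k * exp y \<le> (\<Sum>j<k. (1 - p) ^ s j)" .
  have "(\<Prod>j<k. 1 - (1 - p) ^ s j) \<le> (\<Prod>j<k. exp (- ((1 - p) ^ s j)))"
  proof (intro prod_mono conjI)
    fix j
    show "0 \<le> 1 - (1 - p) ^ s j" using p by (simp add: power_le_one)
    show "1 - (1 - p) ^ s j \<le> exp (- ((1 - p) ^ s j))"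
      using exp_ge_add_one_self[of "- ((1 - p) ^ s j)"] by simp
  qed
  also have "\<dots> = exp (- (\<Sum>j<k. (1 - p) ^ s j))" by (simp add: exp_sum sum_negf[symmetric])
  also have "\<dots> \<le> exp (- (k * exp y))" using sum by simp
  finally show ?thesis by (simp add: y_def)
qed

text \<open>Two blocks of \<open>k\<close> colours. By Markov fewer than \<open>r\<close> vertices
  overflow the first block, up to the first summand. Then each class of the second block has at most
  \<open>r\<close> vertices, so it blocks a given vertex with probability at most
  \<open>p * r\<close>.\<close>

lemma prob_greedy_ge_le:
  fixes p r :: real
  assumes p: "0 \<le> p" "p \<le> 0.99" and k: "0 < k" and r: "0 < r"
  shows "measure_pmf.prob (random_edges n p) {f. \<exists>v<n. 2 * k \<le> greedy f v}
    \<le> n * exp (- (k * exp (- (10 * p * n / k)))) / r + n * (p * r) ^ k"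
proof -
  let ?P = "measure_pmf.prob (random_edges n p)"
  let ?q = "exp (- (k * exp (- (10 * p * n / k))))"
  define X where "X f v = card {u \<in> {..<v}. k \<le> greedy f u}" for f v
  have p1: "p \<le> 1" using p by simp
  have 1: "?P {f. k \<le> greedy f v} \<le> ?q" if "v < n" for v
  proof -
    have "?P {f. k \<le> greedy f v} \<le> ?P {f. True \<and> (\<forall>j\<in>{..<k}. j \<in> greedy f ` {u \<in> {..<v}. f {u, v}})}"
      by (intro measure_pmf.finite_measure_mono subsetI CollectI conjI ballI TrueI greedy_blocked) auto
    also have "\<dots> \<le> ?q"
      using prod_miss_le[OF p k] that
      by (intro prob_greedy_blocked_le[where R = "\<lambda>_. True"] p(1) p1) auto
    finally show ?thesis .
  qed
  have 2: "?P {f. X f v \<le> r \<and> 2 * k \<le> greedy f v} \<le> (p * r) ^ k" if "v < n" for v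
  proof -
    define R where "R s \<longleftrightarrow> (\<forall>j\<in>{k..<2 * k}. real (s j) \<le> r)" for s :: "nat \<Rightarrow> nat"
    have "?P {f. X f v \<le> r \<and> 2 * k \<le> greedy f v}
      \<le> ?P {f. R (\<lambda>j. card {u \<in> {..<v}. greedy f u = j}) \<and>
               (\<forall>j\<in>{k..<2 * k}. j \<in> greedy f ` {u \<in> {..<v}. f {u, v}})}"
    proof (intro measure_pmf.finite_measure_mono subsetI CollectI conjI ballI)
      fix f assume f: "f \<in> {f. X f v \<le> r \<and> 2 * k \<le> greedy f v}"
      have "real (card {u \<in> {..<v}. greedy f u = j}) \<le> X f v" if "k \<le> j" for j
        unfolding X_def using that by (intro of_nat_mono card_mono) auto
      then show "R (\<lambda>j. card {u \<in> {..<v}. greedy f u = j})"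
        using f by (fastforce simp: R_def intro: order_trans)
      fix j assume "j \<in> {k..<2 * k}"
      then show "j \<in> greedy f ` {u \<in> {..<v}. f {u, v}}"
        using f by (intro greedy_blocked) auto
    qed simp
    also have "\<dots> \<le> (p * r) ^ k"
    proof (rule prob_greedy_blocked_le[OF that _ p(1) p1])
      fix s assume "R s"
      have "(\<Prod>j\<in>{k..<2 * k}. 1 - (1 - p) ^ s j) \<le> (\<Prod>j\<in>{k..<2 * k}. p * r)"
      proof (intro prod_mono conjI)
        fix j assume j: "j \<in> {k..<2 * k}"
        show "0 \<le> 1 - (1 - p) ^ s j" using p by (simp add: power_le_one)
        have "1 - (1 - p) ^ s j \<le> s j * p"
          \<comment> \<open>The chance of an edge into a class is at most the expected number of
            such edges.\<close>
          using Bernoulli_inequality[of "- p" "s j"] p by simp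
        also have "\<dots> \<le> r * p" using \<open>R s\<close> j p by (intro mult_right_mono) (auto simp: R_def)
        finally show "1 - (1 - p) ^ s j \<le> p * r" by (simp add: mult.commute)
      qed
      then show "(\<Prod>j\<in>{k..<2 * k}. 1 - (1 - p) ^ s j) \<le> (p * r) ^ k" by simp
    qed (use p r in auto)
    finally show ?thesis .
  qed
  have "{f. \<exists>v<n. 2 * k \<le> greedy f v}
     \<subseteq> {f. r \<le> X f n} \<union> (\<Union>v\<in>{..<n}. {f. X f v \<le> r \<and> 2 * k \<le> greedy f v})"
  proof
    fix f assume "f \<in> {f. \<exists>v<n. 2 * k \<le> greedy f v}"
    then obtain v where v: "v < n" "2 * k \<le> greedy f v" by auto
    \<comment> \<open>The overflow only grows with \<open>v\<close>, so one application of Markov at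
      \<open>n\<close> serves all vertices.\<close>
    have "X f v \<le> X f n" unfolding X_def using v by (intro card_mono) auto
    then show "f \<in> {f. r \<le> X f n} \<union> (\<Union>v\<in>{..<n}. {f. X f v \<le> r \<and> 2 * k \<le> greedy f v})"
      using v by (cases "r \<le> X f n") force+
  qed
  then have "?P {f. \<exists>v<n. 2 * k \<le> greedy f v}
     \<le> ?P ({f. r \<le> X f n} \<union> (\<Union>v\<in>{..<n}. {f. X f v \<le> r \<and> 2 * k \<le> greedy f v}))"
    by (intro measure_pmf.finite_measure_mono) auto
  also have "\<dots> \<le> ?P {f. r \<le> X f n} + ?P (\<Union>v\<in>{..<n}. {f. X f v \<le> r \<and> 2 * k \<le> greedy f v})"
    by (intro measure_Un_le) auto
  also have "\<dots> \<le> n * ?q / r + n * (p * r) ^ k"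
  proof (intro add_mono)
    have "?P {f. r \<le> X f n} \<le> (\<Sum>v\<in>{..<n}. ?P {f. k \<le> greedy f v}) / r"
      unfolding X_def using r by (intro markov_card) auto
    also have "\<dots> \<le> (\<Sum>v\<in>{..<n}. ?q) / r"
      using r 1 by (intro divide_right_mono sum_mono) auto
    finally show "?P {f. r \<le> X f n} \<le> n * ?q / r" by simp
    have "?P (\<Union>v\<in>{..<n}. {f. X f v \<le> r \<and> 2 * k \<le> greedy f v})
        \<le> (\<Sum>v\<in>{..<n}. ?P {f. X f v \<le> r \<and> 2 * k \<le> greedy f v})"
      by (intro measure_pmf.finite_measure_subadditive_finite) auto
    also have "\<dots> \<le> (\<Sum>v\<in>{..<n}. (p * r) ^ k)" using 2 by (intro sum_mono) auto
    finally show "?P (\<Union>v\<in>{..<n}. {f. X f v \<le> r \<and> 2 * k \<le> greedy f v}) \<le> n * (p * r) ^ k"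
      by simp
  qed
  finally show ?thesis .
qed

section \<open>The random graph has a legal system\<close>

text \<open>Only two things can go wrong: first fit uses a colour from \<open>2 * k\<close> on, or
  too many sets are disconnected for \<open>K = 2 * k\<close>.\<close>

lemma prob_no_legal_system_le:
  fixes p r :: real
  assumes p: "0 \<le> p" "p \<le> 0.99" and n: "real n \<le> exp (p * n / 3)" and big: "144 \<le> p * n"
    and k: "0 < k" and r: "0 < r"
  shows "1 - measure_pmf.prob (gnp n p) {E. has_legal_system {..<n} E}
    \<le> n * exp (- (k * exp (- (10 * p * n / k)))) / r + n * (p * r) ^ k
      + 2 ^ (2 * k + 1) * (3 * exp (- (p * n) / 312))"
proof -
  let ?P = "measure_pmf.prob (random_edges n p)"
  have "1 - measure_pmf.prob (gnp n p) {E. has_legal_system {..<n} E}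
     = measure_pmf.prob (gnp n p) {E. \<not> has_legal_system {..<n} E}"
    by (subst measure_pmf.prob_compl[symmetric])
      (auto intro: arg_cong[where f = "measure_pmf.prob (gnp n p)"])
  also have "\<dots> = ?P {f. \<not> has_legal_system {..<n} (edges_of n f)}"
    by (simp add: gnp_def vimage_def)
  also have "\<dots> \<le> ?P ({f. \<exists>v<n. 2 * k \<le> greedy f v}
    \<union> {f. 2 ^ n \<le> 2 ^ (2 * k + 1) * card (disconnected_sets {..<n} (edges_of n f))})"
  proof (intro measure_pmf.finite_measure_mono subsetI)
    fix f assume f: "f \<in> {f. \<not> has_legal_system {..<n} (edges_of n f)}"
    have col: "greedy f u \<noteq> greedy f v" if "{u, v} \<in> edges_of n f" for u v
    proof -
      have "u \<noteq> v" "f {u, v}" using that by (auto simp: all_edges_def)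
      then show ?thesis using greedy_proper[of u v f] greedy_proper[of v u f]
        by (metis insert_commute nat_neq_iff)
    qed
    show "f \<in> {f. \<exists>v<n. 2 * k \<le> greedy f v}
      \<union> {f. 2 ^ n \<le> 2 ^ (2 * k + 1) * card (disconnected_sets {..<n} (edges_of n f))}"
    proof (rule ccontr)
      assume "f \<notin> {f. \<exists>v<n. 2 * k \<le> greedy f v}
        \<union> {f. 2 ^ n \<le> 2 ^ (2 * k + 1) * card (disconnected_sets {..<n} (edges_of n f))}"
      then have "has_legal_system {..<n} (edges_of n f)"
        using col
        by (intro has_legal_system_if_few_disconnected[where c = "greedy f" and K = "2 * k"])
          (auto simp: not_le)
      then show False using f by simp
    qed
  qed simp
  also have "\<dots> \<le> ?P {f. \<exists>v<n. 2 * k \<le> greedy f v}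
    + ?P {f. 2 ^ n \<le> 2 ^ (2 * k + 1) * card (disconnected_sets {..<n} (edges_of n f))}"
    by (intro measure_Un_le) auto
  also have "\<dots> \<le> (n * exp (- (k * exp (- (10 * p * n / k)))) / r + n * (p * r) ^ k)
      + 2 ^ (2 * k + 1) * (3 * exp (- (p * n) / 312))"
    using p by (intro add_mono prob_greedy_ge_le prob_many_disconnected_le n big k r) auto
  finally show ?thesis .
qed

text \<open>With \<open>k \<ge> p n / 4000\<close> colours, a vertex is barred from all of them with probability at most
  \<open>exp (- k exp (- 10 p n / k)) \<le> exp (- 2 \<theta> p n)\<close>.\<close>

definition \<theta> :: real where "\<theta> = exp (- 40000) / 8000"

lemma prob_no_legal_system_le_exp:
  fixes p :: real
  assumes p: "0 \<le> p" "p \<le> 0.99" and n: "real n \<le> exp (p * n / 3)"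
    and big: "4000 \<le> p * n" "4000 / \<theta> \<le> p * n" and large: "p * n \<le> exp (\<theta> * (p * n) / 2)"
  shows "1 - measure_pmf.prob (gnp n p) {E. has_legal_system {..<n} E}
    \<le> exp (- \<theta> * (p * n)) + exp (- (p * n) / 6) + 6 * exp (- (p * n) / 1000)"
proof -
  define x where "x = p * n"
  have \<theta>: "\<theta> > 0" by (simp add: \<theta>_def)
  \<comment> \<open>Small enough for \<open>2 ^ (2 * k)\<close> to lose against
    \<open>exp (- x / 312)\<close>; yet at least \<open>x / 4000\<close> despite rounding, because
    \<open>4000 \<le> x\<close>.\<close>
  define k where "k = nat \<lfloor>x / 2000\<rfloor>"
  have x: "4000 \<le> x" "4000 / \<theta> \<le> x" "x \<le> exp (\<theta> * x / 2)" "real n \<le> exp (x / 3)"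
    using big large n by (auto simp: x_def)
  have "real k = of_int \<lfloor>x / 2000\<rfloor>" using x(1) by (simp add: k_def)
  then have k: "real k \<le> x / 2000" "x / 4000 \<le> real k" using x(1) by linarith+
  then have k0: "0 < k" using x(1) by (cases k) auto
  have n0: "0 < real n" using x(1) by (cases n) (auto simp: x_def)
  \<comment> \<open>Half of the exponent \<open>2 * \<theta> * x\<close> goes into \<open>r\<close>:
    the Markov term keeps a factor \<open>exp (- \<theta> * x)\<close>, and \<open>p * r\<close> is
    still exponentially small.\<close>
  define r where "r = n * exp (- \<theta> * x)"
  have r: "0 < r" using n0 by (simp add: r_def)
  have 1: "n * exp (- (k * exp (- (10 * p * n / k)))) / r \<le> exp (- \<theta> * x)"
  proof -
    have "10 * p * n / k \<le> 40000" using k k0 by (simp add: x_def field_simps)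
    then have "(x / 4000) * exp (- 40000) \<le> k * exp (- (10 * p * n / k))"
      using k x(1) by (intro mult_mono) auto
    moreover have "(x / 4000) * exp (- 40000) = 2 * \<theta> * x" by (simp add: \<theta>_def)
    ultimately have "exp (- (k * exp (- (10 * p * n / k)))) \<le> exp (- (2 * \<theta> * x))"
      by (simp only: exp_le_cancel_iff neg_le_iff_le)
    then have "n * exp (- (k * exp (- (10 * p * n / k)))) / r \<le> n * exp (- (2 * \<theta> * x)) / r"
      using r by (intro divide_right_mono mult_left_mono) auto
    also have "\<dots> = exp (- \<theta> * x)"
      using n0 by (simp add: r_def exp_minus field_simps exp_add[symmetric])
    finally show ?thesis .
  qed
  have 2: "n * (p * r) ^ k \<le> exp (- x / 6)"
  proof -
    have "p * r = x * exp (- \<theta> * x)" by (simp add: r_def x_def)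
    also have "\<dots> \<le> exp (\<theta> * x / 2) * exp (- \<theta> * x)" using x(3) by (intro mult_right_mono) auto
    also have "\<dots> = exp (- \<theta> * x / 2)" by (simp add: exp_add[symmetric])
    finally have "(p * r) ^ k \<le> exp (- \<theta> * x / 2) ^ k" using p r by (intro power_mono) auto
    also have "\<dots> = exp (- (\<theta> * k) * x / 2)" by (simp add: exp_of_nat_mult[symmetric] mult_ac)
    also have "\<dots> \<le> exp (- x / 2)"
    proof -
      \<comment> \<open>With \<open>\<theta> * k\<close> at least 1, the power \<open>k\<close>
        lifts the decay to \<open>exp (- x / 2)\<close>, enough to beat the factor
        \<open>n \<le> exp (x / 3)\<close>.\<close>
      have "1 \<le> \<theta> * (x / 4000)" using x(2) \<theta> by (simp add: field_simps)
      also have "\<dots> \<le> \<theta> * k" using k \<theta> by (intro mult_left_mono) auto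
      finally have "1 * x \<le> \<theta> * k * x" using x(1) by (intro mult_right_mono) auto
      then show ?thesis by simp
    qed
    finally have "n * (p * r) ^ k \<le> exp (x / 3) * exp (- x / 2)"
      using x(4) p r by (intro mult_mono) auto
    also have "\<dots> = exp (- x / 6)" by (simp add: exp_add[symmetric])
    finally show ?thesis .
  qed
  have 3: "2 ^ (2 * k + 1) * (3 * exp (- x / 312)) \<le> 6 * exp (- x / 1000)"
  proof -
    have "(2::real) ^ (2 * k) \<le> exp 1 ^ (2 * k)"
      using exp_ge_add_one_self[of 1] by (intro power_mono) auto
    also have "\<dots> = exp (2 * real k)" by (simp add: exp_of_nat_mult[symmetric])
    also have "\<dots> \<le> exp (x / 1000)" using k by simp
    finally have "2 ^ (2 * k) * exp (- x / 312) \<le> exp (x / 1000) * exp (- x / 312)"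
      by (intro mult_right_mono) auto
    also have "\<dots> = exp (x / 1000 - x / 312)" by (simp add: exp_add[symmetric])
    \<comment> \<open>Here \<open>2 / 1000 \<le> 1 / 312\<close>.\<close>
    also have "\<dots> \<le> exp (- x / 1000)" using x(1) by simp
    finally show ?thesis by simp
  qed
  show ?thesis
    using prob_no_legal_system_le[OF p n _ k0 r] big 1 2 3 unfolding x_def by linarith
qed

text \<open>The lower bound on \<open>p\<close> serves twice: it drives \<open>p n * n\<close> to
  infinity, and it gives \<open>n \<le> exp (p n * n / 3)\<close>. The error is then a fixed
  function of \<open>p n * n\<close> that vanishes at infinity.\<close>

theorem theorem4p1:
  fixes p :: "nat \<Rightarrow> real"
  assumes "\<forall>\<^sub>F n in sequentially. 3 * ln (real n) / real n \<le> p n \<and> p n \<le> 0.99"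
  shows "(\<lambda>n. measure_pmf.prob (gnp n (p n)) {E. has_legal_system {..<n} E}) \<longlonglongrightarrow> 1"
proof -
  define x where "x n = p n * real n" for n
  have \<theta>: "\<theta> > 0" by (simp add: \<theta>_def)
  have ev: "\<forall>\<^sub>F n in sequentially. 3 * ln (real n) \<le> x n \<and> 0 \<le> p n \<and> p n \<le> 0.99 \<and> n > 0"
    using assms eventually_gt_at_top[of 0]
  proof eventually_elim
    case (elim n)
    \<comment> \<open>Nonnegativity of \<open>p n\<close> is read off the lower bound, as
      \<open>ln\<close> is nonnegative from 1 on.\<close>
    then have "0 \<le> 3 * ln (real n) / real n" by simp
    then have "0 \<le> p n" using elim by linarith
    then show ?case using elim by (simp add: x_def field_simps)
  qed
  have "filterlim (\<lambda>n. 3 * ln (real n)) at_top sequentially" by real_asymp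
  then have x: "filterlim x at_top sequentially"
    by (rule filterlim_at_top_mono) (use ev in \<open>auto elim: eventually_mono\<close>)
  define F where "F y = exp (- \<theta> * y) + exp (- y / 6) + 6 * exp (- y / 1000)" for y :: real
  have "((\<lambda>y::real. exp (- \<theta> * y)) \<longlongrightarrow> 0) at_top" using \<theta> by real_asymp
  moreover have "((\<lambda>y::real. exp (- y / 6) + 6 * exp (- y / 1000)) \<longlongrightarrow> 0) at_top" by real_asymp
  ultimately have "(F \<longlongrightarrow> 0) at_top" unfolding F_def add.assoc by (rule tendsto_add_zero)
  then have F: "(\<lambda>n. F (x n)) \<longlonglongrightarrow> 0" using x by (rule filterlim_compose)
  have "\<forall>\<^sub>F y in at_top. 4000 \<le> y \<and> 4000 / \<theta> \<le> y \<and> y \<le> exp (\<theta> * y / 2)"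
  proof (intro eventually_conj eventually_ge_at_top)
    show "\<forall>\<^sub>F y in at_top. y \<le> exp (\<theta> * y / 2)" using \<theta> by real_asymp
  qed
  then have "\<forall>\<^sub>F n in sequentially. 4000 \<le> x n \<and> 4000 / \<theta> \<le> x n \<and> x n \<le> exp (\<theta> * x n / 2)"
    using x by (rule eventually_compose_filterlim)
  then have "\<forall>\<^sub>F n in sequentially.
      norm (1 - measure_pmf.prob (gnp n (p n)) {E. has_legal_system {..<n} E}) \<le> F (x n)"
    using ev
  proof eventually_elim
    case (elim n)
    then have "real n = exp (ln (real n))" by simp
    also have "\<dots> \<le> exp (x n / 3)"
      by (intro iffD2[OF exp_le_cancel_iff]) (use elim in linarith)
    finally show ?case
      using elim prob_no_legal_system_le_exp[of "p n" n]
      by (simp add: F_def x_def measure_pmf.prob_le_1)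
  qed
  then have "(\<lambda>n. 1 - measure_pmf.prob (gnp n (p n)) {E. has_legal_system {..<n} E}) \<longlonglongrightarrow> 0"
    using F by (rule Lim_null_comparison)
  then show ?thesis using tendsto_diff[OF tendsto_const[of 1]] by fastforce
qed

end
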